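(* For every integer $n\ge 1$, the hunter number of the $n$-dimensional hypercube satisfies $$\mathrm{Hun}(Q^n)=1+\sum_{i=0}^{n-2}\binom{i}{\lfloor i/2\rfloor}.$$
   Context: The hypercube $Q^n$ is the graph whose vertices are the subsets of $[n]=\{1,\dots,n\}$, two subsets $x,y$ being adjacent iff $|x\triangle y|=1$. Hunters and Rabbits game on a finite simple graph $G$: a hunter strategy is a finite sequence $H=(H_1,\dots,H_m)$ of multisets of vertices of $G$. For $S\subseteq V(G)$ let $N(S)$ denote the set of vertices adjacent to at least one vertex of $S$. Set $R_H(0)=V(G)$ and $R_H(i)=N(R_H(i-1)\setminus H_i)$ for $1\le i\le m$ (the possible rabbit positions at time $i$). The strategy is winning if $R_H(i)=\emptyset$ for some $i$. The hunter number $\mathrm{Hun}(G)$ is the minimum, over all winning strategies $H$, of $\max_i|H_i|$ (sizes of multisets counted with multiplicity). *)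

theory Defs
  imports
    "Graph_Theory.Pair_Digraph"
    "HOL-Library.Multiset"
begin

text \<open>
  A finite simple graph is a \<^locale>\<open>pair_graph\<close>: a finite, loop-free, symmetric
  digraph without parallel arcs, every edge being represented by its two orientations.
\<close>

definition hypercube :: "nat \<Rightarrow> nat set pair_pre_digraph" where
  "hypercube n =
    \<lparr> pverts = Pow {1..n},
      parcs = {(x, y). x \<in> Pow {1..n} \<and> y \<in> Pow {1..n} \<and> card (sym_diff x y) = 1} \<rparr>"

lemma pair_graph_hypercube: "pair_graph (hypercube n)"
proof
  show "finite (pverts (hypercube n))"
    by (simp add: hypercube_def)
  show "finite (parcs (hypercube n))"
    by (rule finite_subset[of _ "Pow {1..n} \<times> Pow {1..n}"]) (auto simp: hypercube_def)
  show "symmetric (with_proj (hypercube n))"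
    unfolding symmetric_def
    by (auto simp: hypercube_def sym_def Un_commute arcs_ends_def arc_to_ends_def)
qed (auto simp: hypercube_def)

definition nbhd :: "'a pair_pre_digraph \<Rightarrow> 'a set \<Rightarrow> 'a set" where
  "nbhd G S = {v \<in> pverts G. \<exists>u\<in>S. (u, v) \<in> parcs G}"

definition hunter_strategies :: "'a pair_pre_digraph \<Rightarrow> 'a multiset list set" where
  "hunter_strategies G = {H. \<forall>A\<in>set H. set_mset A \<subseteq> pverts G}"

text \<open>
  Lists are indexed from \<open>0\<close>, so the multiset \<open>H\<^sub>i\<close> (\<open>1 \<le> i \<le> m\<close>) of a strategy
  \<open>H = (H\<^sub>1, \<dots>, H\<^sub>m)\<close> is \<open>H ! (i - 1)\<close>. The value of \<open>rabbit_positions G H i\<close> is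
  meaningful only for \<open>i \<le> length H\<close>.
\<close>

primrec rabbit_positions :: "'a pair_pre_digraph \<Rightarrow> 'a multiset list \<Rightarrow> nat \<Rightarrow> 'a set" where
  "rabbit_positions G H 0 = pverts G"
| "rabbit_positions G H (Suc i) = nbhd G (rabbit_positions G H i - set_mset (H ! i))"

definition winning :: "'a pair_pre_digraph \<Rightarrow> 'a multiset list \<Rightarrow> bool" where
  "winning G H \<longleftrightarrow> (\<exists>i\<le>length H. rabbit_positions G H i = {})"

text \<open>
  The inserted \<open>0\<close> only fixes the value for the empty strategy, which wins on the empty
  graph alone.
\<close>

definition num_hunters :: "'a multiset list \<Rightarrow> nat" where
  "num_hunters H = Max (insert 0 (size ` set H))"

text \<open>
  On a finite graph the infimum is a minimum: a single shot at all vertices wins.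
\<close>

definition hunter_number :: "'a pair_pre_digraph \<Rightarrow> nat" where
  "hunter_number G = (INF H\<in>{H \<in> hunter_strategies G. winning G H}. num_hunters H)"

lemma ex_winning:
  assumes "finite (pverts G)"
  shows "\<exists>H\<in>hunter_strategies G. winning G H"
proof
  show "[mset_set (pverts G)] \<in> hunter_strategies G"
    using assms by (simp add: hunter_strategies_def)
  show "winning G [mset_set (pverts G)]"
    using assms by (auto simp: winning_def nbhd_def intro!: exI[of _ "1::nat"])
qed

end

theory Submission
  imports Defs
begin

text \<open>
  The hypercube \<open>Q\<^sup>n\<close> is bipartite, and the rabbit changes its parity class at every step.
  Deleting the element \<open>n\<close> identifies each class with the power set of \<open>X = {1..n-1}\<close>, and
  neighbourhoods in \<open>Q\<^sup>n\<close> then become closed neighbourhoods in \<open>Q\<^sup>n\<^sup>-\<^sup>1\<close>. By Harper's theorem,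
  the initial segments of the simplicial order have the smallest closed neighbourhoods among
  sets of their size, and these neighbourhoods are initial segments again. Splitting at the
  least element of \<open>X\<close> shows that the largest vertex boundary of an initial segment is
  \<open>\<Sum>i<n-1. i choose (i div 2)\<close>. With no more hunters than that, a parity class that once holds
  enough rabbit positions does so forever; with one more, the hunters shrink an initial segment
  by at least one position per shot, clearing one class and then the other.
\<close>

section \<open>The simplicial order and its initial segments\<close>

text \<open>The simplicial order: smaller sets come first, and among sets of equal size the one that
  owns \<open>m\<close>, the least element of the symmetric difference, comes first.\<close>

definition slt :: "'a::linorder set \<Rightarrow> 'a set \<Rightarrow> bool" where
  "slt x y \<longleftrightarrow> card x < card y \<or>
     card x = card y \<and> (\<exists>m\<in>x - y. x \<inter> {..<m} = y \<inter> {..<m})"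

lemma slt_irrefl: "\<not> slt x x"
  by (simp add: slt_def)

lemma slt_card_le: "slt x y \<Longrightarrow> card x \<le> card y"
  unfolding slt_def by linarith

lemma slt_trans:
  assumes "slt x y" "slt y z"
  shows "slt x z"
proof (cases "card x = card y \<and> card y = card z")
  case False
  then have "card x < card z"
    using slt_card_le[OF assms(1)] slt_card_le[OF assms(2)] by linarith
  then show ?thesis by (simp add: slt_def)
next
  case True
  then obtain m k where m: "m \<in> x - y" "x \<inter> {..<m} = y \<inter> {..<m}"
    and k: "k \<in> y - z" "y \<inter> {..<k} = z \<inter> {..<k}"
    using assms unfolding slt_def by (metis less_irrefl)
  have mk: "\<And>j. j < m \<Longrightarrow> j \<in> x \<longleftrightarrow> j \<in> y" "\<And>j. j < k \<Longrightarrow> j \<in> y \<longleftrightarrow> j \<in> z"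
    using m(2) k(2) by blast+
  \<comment> \<open>The first place where \<open>x\<close> and \<open>z\<close> differ is the
    earlier of the two given first differences.\<close>
  have "min m k \<in> x - z"
    using m(1) k(1) mk by (cases m k rule: linorder_cases) auto
  moreover have "x \<inter> {..<min m k} = z \<inter> {..<min m k}"
    using mk by auto
  ultimately show ?thesis using True unfolding slt_def by metis
qed

lemma slt_total:
  assumes "finite x" "finite y" "x \<noteq> y"
  shows "slt x y \<or> slt y x"
proof (cases "card x = card y")
  case True
  let ?m = "Min (sym_diff x y)"
  have fin: "finite (sym_diff x y)" "sym_diff x y \<noteq> {}"
    using assms by auto
  then have "?m \<in> sym_diff x y" by (rule Min_in)
  moreover have "j \<notin> sym_diff x y" if "j < ?m" for j
    using that fin by (meson Min_le leD)
  then have "x \<inter> {..<?m} = y \<inter> {..<?m}" by blast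
  ultimately show ?thesis using True unfolding slt_def by (metis DiffI UnE DiffD1 DiffD2)
qed (auto simp: slt_def)

text \<open>A common new element affects neither the comparison of sizes nor the first difference.
  This transports the order to the half of the cube whose sets contain \<open>i\<close>.\<close>

lemma slt_insert_iff:
  assumes "finite x" "finite y" "i \<notin> x" "i \<notin> y"
  shows "slt (insert i x) (insert i y) \<longleftrightarrow> slt x y"
proof -
  have "insert i x \<inter> {..<m} = insert i y \<inter> {..<m} \<longleftrightarrow> x \<inter> {..<m} = y \<inter> {..<m}" for m
    using assms by (cases "i < m") (simp_all add: Int_insert_left insert_ident)
  moreover have "insert i x - insert i y = x - y" using assms by blast
  ultimately show ?thesis using assms unfolding slt_def by simp
qed

lemma slt_exchange:
  assumes "finite x" "i \<notin> x" "j \<in> x" "i < j"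
  shows "slt (insert i (x - {j})) x"
proof -
  have "card (insert i (x - {j})) = card x"
    using assms card.remove[OF assms(1,3)] by simp
  moreover have "insert i (x - {j}) \<inter> {..<i} = x \<inter> {..<i}"
    using assms by auto
  moreover have "i \<in> insert i (x - {j}) - x" using assms by blast
  ultimately show ?thesis unfolding slt_def by blast
qed

lemma slt_psubset: "finite y \<Longrightarrow> x \<subset> y \<Longrightarrow> slt x y"
  by (simp add: slt_def psubset_card_mono)

definition initial :: "'a::linorder set \<Rightarrow> 'a set set \<Rightarrow> bool" where
  "initial X I \<longleftrightarrow> I \<subseteq> Pow X \<and> (\<forall>y\<in>I. \<forall>x\<in>Pow X. slt x y \<longrightarrow> x \<in> I)"

lemma initialD: "initial X I \<Longrightarrow> y \<in> I \<Longrightarrow> x \<subseteq> X \<Longrightarrow> slt x y \<Longrightarrow> x \<in> I"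
  by (auto simp: initial_def)

lemma initial_subset: "initial X I \<Longrightarrow> I \<subseteq> Pow X"
  by (auto simp: initial_def)

lemma initial_finite: "finite X \<Longrightarrow> initial X I \<Longrightarrow> finite I"
  by (meson finite_Pow_iff finite_subset initial_subset)

lemma initial_total:
  assumes "finite X" "initial X I" "initial X J"
  shows "I \<subseteq> J \<or> J \<subseteq> I"
proof (rule ccontr)
  assume "\<not> ?thesis"
  then obtain x y where xy: "x \<in> I" "x \<notin> J" "y \<in> J" "y \<notin> I" by blast
  moreover have "x \<subseteq> X" "y \<subseteq> X" using xy assms initial_subset by blast+
  moreover from this have "finite x" "finite y" using assms(1) finite_subset by blast+
  ultimately show False using slt_total[of x y] initialD assms by blast
qed

text \<open>Initial segments of a total order are nested, so the union is the larger one. In the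
  compression step this turns sizes of unions of slices into maxima.\<close>

lemma initial_card_Un:
  assumes "finite X" "initial X I" "initial X J"
  shows "card (I \<union> J) = max (card I) (card J)"
  using initial_total[OF assms] initial_finite[OF assms(1)] assms
  by (metis card_mono max.absorb1 max.absorb2 sup.absorb1 sup.absorb2)

lemma ex_slt_max:
  assumes "finite X" "S \<subseteq> Pow X" "S \<noteq> {}"
  shows "\<exists>y\<in>S. \<forall>x\<in>S. x \<noteq> y \<longrightarrow> slt x y"
proof -
  have "finite S" using assms by (meson finite_Pow_iff finite_subset)
  then show ?thesis using assms(3,2)
  proof (induction S rule: finite_ne_induct)
    case (insert a F)
    then obtain y where y: "y \<in> F" "\<forall>x\<in>F. x \<noteq> y \<longrightarrow> slt x y" by auto
    then have "finite a" "finite y" "a \<noteq> y"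
      using insert.prems insert.hyps assms(1) by (auto intro: finite_subset[of _ X])
    from slt_total[OF this] show ?case
    proof
      assume "slt a y"
      then show ?thesis using y by blast
    next
      assume "slt y a"
      then show ?thesis using y by (metis insertE insertI1 slt_trans)
    qed
  qed auto
qed

text \<open>Deleting the last set of an initial segment leaves an initial segment, so every smaller
  size is reached one deletion at a time.\<close>

lemma ex_initial_card:
  assumes "finite X" "initial X I" "k \<le> card I"
  shows "\<exists>J. initial X J \<and> J \<subseteq> I \<and> card J = k"
  using assms(2,3)
proof (induction "card I" arbitrary: I)
  case 0
  then show ?case by auto
next
  case (Suc c)
  show ?case
  proof (cases "k = Suc c")
    case True
    then show ?thesis using Suc by auto
  next
    case False
    have "I \<noteq> {}" using Suc by auto
    then obtain y where y: "y \<in> I" "\<forall>x\<in>I. x \<noteq> y \<longrightarrow> slt x y"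
      using ex_slt_max assms(1) initial_subset Suc by metis
    have "initial X (I - {y})"
      unfolding initial_def
    proof (intro conjI ballI impI)
      fix w x assume wx: "w \<in> I - {y}" "x \<in> Pow X" "slt x w"
      then have "x \<in> I" using initialD[OF Suc.prems(1)] by blast
      moreover have "slt w y" using wx y by blast
      then have "x \<noteq> y" using slt_trans[OF wx(3)] slt_irrefl by blast
      ultimately show "x \<in> I - {y}" by blast
    qed (use initial_subset[OF Suc.prems(1)] in blast)
    moreover have "card (I - {y}) = c" using Suc y initial_finite[OF assms(1)] by auto
    moreover have "k \<le> c" using False Suc by simp
    ultimately show ?thesis using Suc.hyps(1)[of "I - {y}"] by blast
  qed
qed

lemma initial_Pow: "initial X (Pow X)"
  by (auto simp: initial_def)

section \<open>Closed neighbourhoods in the cube of subsets\<close>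

text \<open>The inserted element may already be present, so this says that the two sets differ in at
  most one element.\<close>

definition near :: "'a set \<Rightarrow> 'a set \<Rightarrow> bool" where
  "near u v \<longleftrightarrow> u = v \<or> (\<exists>j. v = insert j u \<or> u = insert j v)"

definition nb :: "'a set \<Rightarrow> 'a set set \<Rightarrow> 'a set set" where
  "nb X S = {v \<in> Pow X. \<exists>u\<in>S. near u v}"

lemma near_refl: "near u u"
  by (simp add: near_def)

lemma near_remove: "near (v - {j}) v"
  unfolding near_def by (cases "j \<in> v") (auto simp: insert_absorb)

lemma nb_subset: "nb X S \<subseteq> Pow X"
  by (auto simp: nb_def)

lemma nb_finite: "finite X \<Longrightarrow> finite (nb X S)"
  by (auto simp: nb_def)

lemma subset_nb: "S \<subseteq> Pow X \<Longrightarrow> S \<subseteq> nb X S"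
  by (auto simp: nb_def near_def)

text \<open>A neighbour \<open>w\<close> outside \<open>I\<close> is some \<open>z\<close> in
  \<open>I\<close> plus one element. If \<open>v\<close> comes before \<open>w\<close>, delete the
  largest element of \<open>v\<close>, which gives the earliest set obtainable by one deletion. It
  equals or precedes \<open>z\<close>, so it lies in \<open>I\<close>, and \<open>v\<close> is near
  it.\<close>

lemma initial_nb:
  assumes "finite X" "initial X I"
  shows "initial X (nb X I)"
  unfolding initial_def
proof (intro conjI ballI impI)
  fix w v
  assume w: "w \<in> nb X I" and v: "v \<in> Pow X" and lt: "slt v w"
  have I: "u \<in> I \<Longrightarrow> u \<in> nb X I" for u
    using subset_nb[OF initial_subset[OF assms(2)]] by auto
  have nbI: "v \<in> nb X I" if "v - {j} \<in> I" for j
    using that v near_remove[of v j] by (auto simp: nb_def)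
  have finv: "finite v" using v assms(1) finite_subset by blast
  from w obtain z where z: "z \<in> I" "near z w" by (auto simp: nb_def)
  have zX: "z \<subseteq> X" using z initial_subset[OF assms(2)] by auto
  then have finz: "finite z" using assms(1) finite_subset by blast
  have wX: "w \<subseteq> X" using w by (auto simp: nb_def)
  show "v \<in> nb X I"
  proof (cases "w \<in> I")
    case True
    then show ?thesis using initialD[OF assms(2)] v lt I by auto
  next
    case False
    have "\<not> w \<subset> z" using False initialD[OF assms(2) z(1) wX] slt_psubset[OF finz] by blast
    then obtain j where j: "w = insert j z" "j \<notin> z"
      using z False unfolding near_def by (metis insert_absorb psubsetI subset_insertI)
    have cw: "card w = Suc (card z)" using j finz by simp
    show ?thesis
    proof (cases "v = {}")
      case True
      then show ?thesis using I z initialD[OF assms(2) z(1), of "{}"] slt_psubset[OF finz, of "{}"]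
        by (metis empty_subsetI psubsetI)
    next
      case ne: False
      let ?v = "v - {Max v}"
      have mv: "Max v \<in> v" "\<And>k. k \<in> v \<Longrightarrow> k \<le> Max v" using ne finv by auto
      have cv: "card v = Suc (card ?v)" using card.remove[OF finv mv(1)] .
      have sub: "?v \<subseteq> X" using v by auto
      \<comment> \<open>For equal sizes of \<open>v\<close> and \<open>w\<close>, look at their
        first difference \<open>m\<close>. If \<open>j < m\<close>, then \<open>j\<close> lies in
        \<open>v\<close> and is the first difference of \<open>?v\<close> and \<open>z\<close>. If
        \<open>j > m\<close>, that difference is \<open>m\<close>, unless \<open>m\<close> is the
        deleted \<open>Max v\<close>; then \<open>?v\<close> is contained in \<open>z\<close>, and
        equal sizes force equality.\<close>
      have "?v = z \<or> slt ?v z"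
      proof (cases "card v = card w")
        case False
        then have "card ?v < card z" using lt cw cv by (auto simp: slt_def)
        then show ?thesis by (simp add: slt_def)
      next
        case True
        then obtain m where m: "m \<in> v - w" "v \<inter> {..<m} = w \<inter> {..<m}"
          using lt by (auto simp: slt_def)
        have ag: "\<And>k. k < m \<Longrightarrow> k \<in> v \<longleftrightarrow> k \<in> w" using m(2) by blast
        have ceq: "card ?v = card z" using True cw cv by simp
        have jm: "j \<noteq> m" using m(1) j by auto
        have mle: "m \<le> Max v" using m mv by auto
        show ?thesis
        proof (cases "j < m")
          case True
          have "j \<in> ?v - z" using ag[OF True] j True mle by auto
          moreover have "?v \<inter> {..<j} = z \<inter> {..<j}"
            using ag True j mle by auto
          ultimately show ?thesis using ceq unfolding slt_def by blast
        next
          case False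
          show ?thesis
          proof (cases "m = Max v")
            case True
            have "?v \<subseteq> z"
            proof
              fix k assume k: "k \<in> ?v"
              then have "k < m" using mv True by (metis DiffD1 DiffD2 le_neq_trans singletonI)
              then show "k \<in> z" using ag k j False by auto
            qed
            then show ?thesis using ceq finz card_subset_eq by blast
          next
            case ne: False
            have "m \<in> ?v - z" using m ne j by auto
            moreover have "?v \<inter> {..<m} = z \<inter> {..<m}"
              using ag j False mle by auto
            ultimately show ?thesis using ceq unfolding slt_def by blast
          qed
        qed
      qed
      then have "?v \<in> I" using z(1) initialD[OF assms(2) z(1) sub] by auto
      then show ?thesis by (rule nbI)
    qed
  qed
qed (rule nb_subset)

section \<open>Harper's theorem\<close>

text \<open>Assembles a family from its two slices in direction \<open>i\<close>: \<open>A\<close>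
  holds the members avoiding \<open>i\<close>, and \<open>B\<close> the members containing
  \<open>i\<close>, with \<open>i\<close> deleted.\<close>

definition glue :: "'a \<Rightarrow> 'a set set \<Rightarrow> 'a set set \<Rightarrow> 'a set set" where
  "glue i A B = A \<union> insert i ` B"

lemma glue_subset: "A \<subseteq> Pow Y \<Longrightarrow> B \<subseteq> Pow Y \<Longrightarrow> glue i A B \<subseteq> Pow (insert i Y)"
  by (auto simp: glue_def)

lemma ex_glue:
  assumes "S \<subseteq> Pow (insert i Y)"
  shows "\<exists>A\<subseteq>Pow Y. \<exists>B\<subseteq>Pow Y. S = glue i A B"
proof -
  have "x \<in> insert i ` {x \<in> Pow Y. insert i x \<in> S}" if "x \<in> S" "\<not> x \<subseteq> Y" for x
  proof -
    have "i \<in> x" "x - {i} \<subseteq> Y" using that assms by auto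
    then show ?thesis using that by (intro image_eqI[of _ _ "x - {i}"]) (auto simp: insert_absorb)
  qed
  then have "S = glue i (S \<inter> Pow Y) {x \<in> Pow Y. insert i x \<in> S}"
    unfolding glue_def by blast
  moreover have "S \<inter> Pow Y \<subseteq> Pow Y" "{x \<in> Pow Y. insert i x \<in> S} \<subseteq> Pow Y"
    by auto
  ultimately show ?thesis by (meson order_refl)
qed

lemma inj_on_insert_Pow: "i \<notin> Y \<Longrightarrow> inj_on (insert i) (Pow Y)"
  by (intro inj_onI) (simp, metis insert_ident subsetD)

lemma
  assumes "i \<notin> Y" "A \<subseteq> Pow Y" "B \<subseteq> Pow Y"
  shows mem_glue: "x \<subseteq> Y \<Longrightarrow> x \<in> glue i A B \<longleftrightarrow> x \<in> A"
    and insert_mem_glue: "x \<subseteq> Y \<Longrightarrow> insert i x \<in> glue i A B \<longleftrightarrow> x \<in> B"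
proof -
  show "x \<subseteq> Y \<Longrightarrow> x \<in> glue i A B \<longleftrightarrow> x \<in> A"
    using assms(1) by (auto simp: glue_def)
  show "insert i x \<in> glue i A B \<longleftrightarrow> x \<in> B" if "x \<subseteq> Y"
  proof -
    have "insert i x \<notin> A" using assms by auto
    then show ?thesis
      using inj_on_image_mem_iff[OF inj_on_insert_Pow[OF assms(1)], of x B] assms that
      by (auto simp: glue_def)
  qed
qed

lemma sum_glue:
  fixes f :: "'a set \<Rightarrow> nat"
  assumes "finite Y" "i \<notin> Y" "A \<subseteq> Pow Y" "B \<subseteq> Pow Y"
  shows "sum f (glue i A B) = sum f A + (\<Sum>x\<in>B. f (insert i x))"
proof -
  have "finite A" "finite B" using assms by (meson finite_Pow_iff finite_subset)+
  moreover have "A \<inter> insert i ` B = {}" using assms by auto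
  moreover have "inj_on (insert i) B"
    using inj_on_insert_Pow assms inj_on_subset by metis
  ultimately show ?thesis
    by (simp add: glue_def sum.union_disjoint sum.reindex)
qed

lemma card_glue:
  assumes "finite Y" "i \<notin> Y" "A \<subseteq> Pow Y" "B \<subseteq> Pow Y"
  shows "card (glue i A B) = card A + card B"
  using sum_glue[OF assms, of "\<lambda>_. 1"] by simp

lemma near_insert_insert:
  assumes "i \<notin> u" "i \<notin> v"
  shows "near (insert i u) (insert i v) \<longleftrightarrow> near u v"
proof
  have "w = z \<or> w = insert j z" if "insert i w = insert j (insert i z)" "i \<notin> w" "i \<notin> z" for w z j
  proof (cases "j = i")
    case False
    then have "insert i w = insert i (insert j z)" "i \<notin> insert j z"
      using that by (simp_all add: insert_commute)
    then show ?thesis using that(2) by (simp add: insert_ident)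
  qed (use that in \<open>simp add: insert_ident\<close>)
  then show "near (insert i u) (insert i v) \<Longrightarrow> near u v"
    using assms unfolding near_def by (metis insert_ident)
qed (auto simp: near_def insert_commute)

text \<open>A set avoiding \<open>i\<close> and a set containing it already differ at
  \<open>i\<close>, so nearness allows no other difference.\<close>

lemma near_insert_iff:
  assumes "i \<notin> u" "i \<notin> v"
  shows "near u (insert i v) \<longleftrightarrow> u = v" "near (insert i u) v \<longleftrightarrow> u = v"
proof -
  have "insert i a = insert j b \<longleftrightarrow> j = i \<and> a = b" if "i \<notin> a" "i \<notin> b" for a b j
  proof (cases "j = i")
    case False
    then have "i \<notin> insert j b" using that by simp
    then show ?thesis using False by (metis insertI1)
  qed (use that in \<open>simp add: insert_ident\<close>)
  then show "near u (insert i v) \<longleftrightarrow> u = v" "near (insert i u) v \<longleftrightarrow> u = v"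
    using assms unfolding near_def by auto
qed

text \<open>Moves that keep \<open>i\<close> fixed enlarge each slice to its own neighbourhood;
  moves in direction \<open>i\<close> copy each slice into the other half.\<close>

lemma nb_glue:
  assumes "i \<notin> Y" "A \<subseteq> Pow Y" "B \<subseteq> Pow Y"
  shows "nb (insert i Y) (glue i A B) = glue i (nb Y A \<union> B) (nb Y B \<union> A)"
proof -
  have *: "nb Y A \<union> B \<subseteq> Pow Y" "nb Y B \<union> A \<subseteq> Pow Y"
    using assms nb_subset[of Y] by blast+
  have bex: "(\<exists>u\<in>glue i A B. P u) \<longleftrightarrow> (\<exists>u\<in>A. P u) \<or> (\<exists>u\<in>B. P (insert i u))" for P
    by (auto simp: glue_def)
  have iA: "u \<in> A \<Longrightarrow> i \<notin> u" and iB: "u \<in> B \<Longrightarrow> i \<notin> u" for u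
    using assms by auto
  have "v \<in> nb (insert i Y) (glue i A B) \<longleftrightarrow> v \<in> glue i (nb Y A \<union> B) (nb Y B \<union> A)"
    if "v \<subseteq> insert i Y" for v
  proof (cases "i \<in> v")
    case False
    then have v: "v \<subseteq> Y" using that by auto
    show ?thesis
      unfolding mem_glue[OF assms(1) * v]
      using v False by (auto simp: nb_def bex near_insert_iff iA iB)
  next
    case True
    define w where "w = v - {i}"
    have w: "w \<subseteq> Y" "i \<notin> w" "v = insert i w" using that True by (auto simp: w_def)
    show ?thesis
      unfolding w(3) insert_mem_glue[OF assms(1) * w(1)]
      using w by (auto simp: nb_def bex near_insert_iff near_insert_insert iA iB)
  qed
  then show ?thesis
    using nb_subset[of "insert i Y" "glue i A B"] glue_subset[OF *, of i]
    by (intro subset_antisym subsetI) (metis Pow_iff subsetD)+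
qed

section \<open>Compression in one direction\<close>

text \<open>Each half of a neighbourhood is a union of one slice's neighbourhood with the other
  slice. Its size is at least the maximum of the two sizes, with equality when the slices are
  initial, since neighbourhoods of initial segments are again initial and hence nested with the
  other slice.\<close>

lemma card_nb_glue_initial_le:
  assumes "finite Y" "i \<notin> Y" "A \<subseteq> Pow Y" "B \<subseteq> Pow Y" "initial Y A'" "initial Y B'"
    and "card (nb Y A') \<le> card (nb Y A)" "card (nb Y B') \<le> card (nb Y B)"
    and "card A' = card A" "card B' = card B"
  shows "card (nb (insert i Y) (glue i A' B')) \<le> card (nb (insert i Y) (glue i A B))"
proof -
  have step: "card (nb Y U' \<union> V') \<le> card (nb Y U \<union> V)"
    if "V \<subseteq> Pow Y" "initial Y U'" "initial Y V'"
      "card (nb Y U') \<le> card (nb Y U)" "card V' = card V" for U V U' V'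
  proof -
    have fin: "finite (nb Y U \<union> V)"
      using nb_finite[OF assms(1)] that(1) assms(1) by (meson finite_Pow_iff finite_UnI finite_subset)
    have "card (nb Y U' \<union> V') = max (card (nb Y U')) (card V')"
      using initial_card_Un[OF assms(1) initial_nb[OF assms(1) that(2)] that(3)] .
    also have "\<dots> \<le> max (card (nb Y U)) (card V)" using that by auto
    also have "\<dots> \<le> card (nb Y U \<union> V)"
      using fin by (simp add: card_mono)
    finally show ?thesis .
  qed
  have sub: "A' \<subseteq> Pow Y" "B' \<subseteq> Pow Y" using assms initial_subset by blast+
  have "nb Y C \<union> D \<subseteq> Pow Y" if "D \<subseteq> Pow Y" for C D
    using that nb_subset[of Y] by blast
  then show ?thesis
    using assms sub step[of B A' B' A] step[of A B' A' B]
    by (simp add: nb_glue card_glue add_mono)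
qed

text \<open>Every set of \<open>J - A\<close> precedes every set of \<open>A - J\<close>, because
  \<open>J\<close> is initial. A bijection between these differences therefore raises
  \<open>g\<close> at each point. With \<open>g\<close> a rank, this makes compression decrease the
  termination measure.\<close>

lemma sum_initial_le:
  fixes g :: "'a::linorder set \<Rightarrow> nat"
  assumes "finite Y" "initial Y J" "A \<subseteq> Pow Y" "card A = card J"
    and mono: "\<And>x y. x \<subseteq> Y \<Longrightarrow> y \<subseteq> Y \<Longrightarrow> slt x y \<Longrightarrow> g x < g y"
  shows "sum g J \<le> sum g A" and "A \<noteq> J \<Longrightarrow> sum g J < sum g A"
proof -
  have fin: "finite A" "finite J"
    using assms(1,3) initial_finite[OF assms(1,2)] by (meson finite_Pow_iff finite_subset, simp)
  have "card (J - A) = card (A - J)"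
    using fin assms(4) by (simp add: card_Diff_subset_Int inf_commute)
  then obtain h where h: "bij_betw h (J - A) (A - J)"
    using fin by (meson bij_betw_iff_card finite_Diff)
  have lt: "g x < g (h x)" if "x \<in> J - A" for x
  proof -
    have hx: "h x \<in> A - J" using bij_betwE[OF h] that by blast
    have sub: "x \<subseteq> Y" "h x \<subseteq> Y" using that hx assms(3) initial_subset[OF assms(2)] by blast+
    then have "finite x" "finite (h x)" using assms(1) by (auto intro: finite_subset)
    moreover have "x \<noteq> h x" "\<not> slt (h x) x"
      using initialD[OF assms(2) _ sub(2)] that hx by auto
    ultimately have "slt x (h x)"
      using slt_total by blast
    then show ?thesis by (rule mono[OF sub])
  qed
  have re: "sum g (A - J) = (\<Sum>x\<in>J - A. g (h x))"
    using sum.reindex_bij_betw[OF h, of g] by simp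
  have s: "sum g A = sum g (A \<inter> J) + sum g (A - J)" "sum g J = sum g (A \<inter> J) + sum g (J - A)"
    using sum.Int_Diff[OF fin(1), of g J] sum.Int_Diff[OF fin(2), of g A] by (simp_all add: inf_commute)
  show "sum g J \<le> sum g A"
    unfolding s re using lt by (intro add_left_mono sum_mono less_imp_le)
  assume "A \<noteq> J"
  then have "J - A \<noteq> {}"
    using assms(4) fin card_subset_eq[of A J] by auto
  then have "sum g (J - A) < (\<Sum>x\<in>J - A. g (h x))"
    using lt fin by (intro sum_strict_mono) auto
  then show "sum g J < sum g A" unfolding s re by simp
qed

text \<open>
  The only set that is compressed in every direction without being initial is an initial
  segment whose last element \<open>y\<close> replaces its immediate predecessor, the complement of \<open>y\<close>.
\<close>

lemma card_nb_initial_le_compressed: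
  assumes "finite X" "S \<subseteq> Pow X" "initial X I" "card I = card S"
    and compr: "\<And>i x y. i \<in> X \<Longrightarrow> x \<subseteq> X \<Longrightarrow> y \<in> S \<Longrightarrow> slt x y \<Longrightarrow> (i \<in> x \<longleftrightarrow> i \<in> y) \<Longrightarrow> x \<in> S"
  shows "card (nb X I) \<le> card (nb X S)"
proof (cases "initial X S")
  case True
  then have "I = S"
    using initial_total[OF assms(1,3) True] assms(4)
    by (metis assms(1,3) card_subset_eq initial_finite)
  then show ?thesis by simp
next
  case False
  have finX: "finite z" if "z \<subseteq> X" for z using that assms(1) finite_subset by blast
  \<comment> \<open>If the two sets agreed about any \<open>i\<close>, compression in direction
    \<open>i\<close> would put \<open>x\<close> into \<open>S\<close>; so they disagree
    everywhere.\<close>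
  have co: "x = X - y" if "x \<subseteq> X" "y \<in> S" "slt x y" "x \<notin> S" for x y
    using that compr[of _ x y] assms(2) by blast
  from False obtain x' y' where xy': "x' \<subseteq> X" "y' \<in> S" "slt x' y'" "x' \<notin> S"
    using assms(2) unfolding initial_def by blast
  obtain y where y: "y \<in> S" "\<And>z. z \<in> S \<Longrightarrow> z \<noteq> y \<Longrightarrow> slt z y"
    using ex_slt_max[OF assms(1,2)] xy'(2) by blast
  have yX: "y \<subseteq> X" using y assms(2) by auto
  define x where "x = X - y"
  have "slt x' y" using xy' y slt_trans by metis
  then have "x' = x" using co xy' y x_def by blast
  then have x: "x \<subseteq> X" "slt x y" "x \<notin> S" using xy' \<open>slt x' y\<close> by auto
  have below: "z \<in> S" if "z \<subseteq> X" "slt z y" "z \<noteq> x" for z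
    using co[OF that(1) y(1) that(2)] that(3) x_def by blast
  \<comment> \<open>A set \<open>z\<close> strictly between would belong to \<open>S\<close> and
    come after the missing \<open>x\<close>, so \<open>x\<close> would be the complement of
    \<open>z\<close> as well as of \<open>y\<close>.\<close>
  have gap: False if "z \<subseteq> X" "slt x z" "slt z y" for z
  proof -
    have "z \<noteq> x" "z \<noteq> y" using that slt_irrefl by blast+
    then have "x = X - z" using co x below that by blast
    then show False using \<open>z \<noteq> y\<close> that(1) yX x_def by blast
  qed
  define J where "J = insert x (S - {y})"
  have J: "J = {z \<in> Pow X. slt z y}"
    using below x y slt_irrefl assms(2) unfolding J_def by blast
  then have "initial X J"
    unfolding initial_def using slt_trans[of _ _ y] by blast
  moreover have "card J = card S"
    using x y card.remove[of S y] finite_subset[OF assms(2)] assms(1) by (simp add: J_def)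
  ultimately have IJ: "I = J"
    using initial_total[OF assms(1,3)] assms(4)
    by (metis assms(1,3) card_subset_eq initial_finite)
  have nbS: "w \<in> nb X S" if "z \<in> S" "near z w" "w \<subseteq> X" for z w
    using that by (auto simp: nb_def)
  \<comment> \<open>The initial segment \<open>J\<close> differs from \<open>S\<close> only in
    having \<open>x\<close> for \<open>y\<close>, so only neighbours of \<open>x\<close> have to be
    recovered from \<open>S\<close>.\<close>
  have "w \<in> nb X S" if w: "w \<subseteq> X" "near x w" for w
  proof (cases "x = {}")
    case True
    then have yX: "y = X" using x_def yX by auto
    have "X \<noteq> {}" using x True yX slt_irrefl by blast
    then obtain a where a: "a \<in> X" by auto
    \<comment> \<open>Otherwise \<open>{a}\<close> would lie strictly between the empty set and
      \<open>X\<close>.\<close>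
    have "X = {a}"
    proof (rule ccontr)
      assume "X \<noteq> {a}"
      then have "slt {a} y" "slt x {a}"
        using a assms(1) yX True by (auto intro!: slt_psubset)
      then show False using gap a by blast
    qed
    then have "near y w" using w yX by (auto simp: near_def dest!: subset_singletonD)
    then show ?thesis using nbS y w by blast
  next
    case False
    have sub: "z \<in> S" if "z \<subset> x" for z
      using that below[of z] slt_trans[OF slt_psubset[OF finX[OF x(1)] that] x(2)] x(1) by blast
    show ?thesis
    proof (cases "w \<subseteq> x")
      case True
      then show ?thesis
      proof (cases "w = x")
        case True
        obtain j where "j \<in> x" using False by auto
        then have "x - {j} \<in> S" using sub by blast
        then show ?thesis using True nbS near_remove[of x j] w by blast
      next
        case False
        then show ?thesis using sub[of w] True nbS[OF _ near_refl[of w]] w by blast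
      qed
    next
      case nsub: False
      then obtain i where i: "w = insert i x" "i \<notin> x"
        using w unfolding near_def by blast
      then have iy: "i \<in> y" using w x_def by auto
      show ?thesis
      \<comment> \<open>If some \<open>j\<close> in \<open>x\<close> exceeds \<open>i\<close>,
        trading \<open>j\<close> for \<open>i\<close> gives a set before \<open>x\<close>, hence in
        \<open>S\<close>, that is still near \<open>w\<close>. Otherwise trading the largest element
        \<open>k\<close> for \<open>i\<close> gives a set after \<open>x\<close>, which by
        \<open>gap\<close> cannot precede \<open>y\<close>; this will force \<open>x\<close> and
        \<open>y\<close> to be singletons.\<close>
      proof (cases "\<exists>j\<in>x. i < j")
        case True
        then obtain j where j: "j \<in> x" "i < j" by auto
        let ?z = "insert i (x - {j})"
        have zx: "slt ?z x" using slt_exchange[OF finX[OF x(1)] i(2) j] .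
        then have "?z \<in> S"
          using below[of ?z] slt_trans[OF zx x(2)] i(2) x(1) w(1) i(1) by blast
        moreover have "near ?z w" using i j unfolding near_def by blast
        ultimately show ?thesis using nbS w by blast
      next
        case top: False
        define k where "k = Max x"
        have k: "k \<in> x" "\<And>j. j \<in> x \<Longrightarrow> j \<le> k"
          using False finX[OF x(1)] by (auto simp: k_def)
        have ki: "k < i" using top k i by (metis linorder_neqE)
        let ?z = "insert i (x - {k})"
        have zX: "?z \<subseteq> X" using x w i by auto
        have "slt (insert k (?z - {i})) ?z"
          using slt_exchange[OF finX[OF zX], of k i] ki by auto
        moreover have "insert k (?z - {i}) = x" using i k by auto
        ultimately have nz: "\<not> slt ?z y" using gap[OF zX] by auto
        have cz: "card ?z = card x"
          using card.remove[OF finX[OF x(1)] k(1)] i finX[OF x(1)] by simp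
        then have "card x = card y"
          using nz x(2) by (auto simp: slt_def)
        then obtain m where m: "m \<in> x - y" "x \<inter> {..<m} = y \<inter> {..<m}"
          using x(2) unfolding slt_def by (metis less_irrefl)
        \<comment> \<open>Complementary sets that agree below \<open>m\<close> have no elements
          there.\<close>
        have e: "x \<inter> {..<m} = {}" using m(2) x_def by blast
        have "m = k"
        proof (rule ccontr)
          assume "m \<noteq> k"
          then have "m \<in> ?z - y" using m by auto
          moreover have "m < i" using m k ki by fastforce
          then have "?z \<inter> {..<m} = y \<inter> {..<m}" using e m(2) by auto
          ultimately show False using nz cz \<open>card x = card y\<close> unfolding slt_def by metis
        qed
        then have "x = {k}" using e k by (force simp: order_le_less)
        then have "card y = 1" using \<open>card x = card y\<close> by simp
        then have "y = {i}" using iy by (auto simp: card_1_singleton_iff)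
        then have "near y w" using i \<open>x = {k}\<close> by (auto simp: near_def)
        then show ?thesis using nbS y w by blast
      qed
    qed
  qed
  then have "nb X J \<subseteq> nb X S"
    unfolding J_def nb_def by blast
  then show ?thesis using IJ card_mono nb_finite[OF assms(1)] by blast
qed

text \<open>Outer induction on the ground set, inner induction on the total rank of
  \<open>S\<close>. If some direction has a slice that is not initial, replace both slices by
  initial segments of the same sizes: the outer hypothesis shows that the neighbourhood does not
  grow, and the total rank drops. Otherwise \<open>S\<close> is compressed in every
  direction.\<close>

theorem harper:
  assumes "finite X" "S \<subseteq> Pow X" "initial X I" "card I = card S"
  shows "card (nb X I) \<le> card (nb X S)"
  using assms
proof (induction X arbitrary: S I rule: finite_psubset_induct)
  case (psubset X)
  \<comment> \<open>The position of a set in the simplicial order; only its strict monotonicity is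
    used.\<close>
  define rk where "rk x = card {z \<in> Pow X. slt z x}" for x
  have rk: "rk x < rk y" if "x \<subseteq> X" "slt x y" for x y
  proof -
    have "{z \<in> Pow X. slt z x} \<subset> {z \<in> Pow X. slt z y}"
      using that slt_trans[of _ x y] slt_irrefl[of x] by blast
    then show ?thesis unfolding rk_def using psubset.hyps by (auto intro!: psubset_card_mono)
  qed
  show ?case using psubset.prems
  proof (induction "sum rk S" arbitrary: S rule: less_induct)
    case less
    show ?case
    proof (cases "\<forall>i\<in>X. \<exists>A B. initial (X - {i}) A \<and> initial (X - {i}) B \<and> S = glue i A B")
      case True
      show ?thesis
      proof (rule card_nb_initial_le_compressed[OF psubset.hyps less.prems])
        fix i x y
        assume i: "i \<in> X" and xy: "x \<subseteq> X" "y \<in> S" "slt x y" "i \<in> x \<longleftrightarrow> i \<in> y"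
        define Y where "Y = X - {i}"
        have fin: "finite u" if "u \<subseteq> Y" for u
          using that psubset.hyps finite_subset unfolding Y_def by blast
        from True i obtain A B where AB: "initial Y A" "initial Y B" "S = glue i A B"
          unfolding Y_def by blast
        have sub: "i \<notin> Y" "A \<subseteq> Pow Y" "B \<subseteq> Pow Y"
          using AB initial_subset by (auto simp: Y_def)
        show "x \<in> S"
        proof (cases "i \<in> x")
          case False
          then have "x \<subseteq> Y" "y \<subseteq> Y" using xy less.prems(1) by (auto simp: Y_def)
          then show ?thesis
            using xy AB initialD mem_glue[OF sub] by blast
        next
          case True
          define x' y' where "x' = x - {i}" and "y' = y - {i}"
          have "i \<in> y" using True xy by simp
          have x': "x = insert i x'" "x' \<subseteq> Y" "i \<notin> x'"
            using True xy by (auto simp: x'_def Y_def)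
          have y': "y = insert i y'" "y' \<subseteq> Y" "i \<notin> y'"
            using \<open>i \<in> y\<close> xy less.prems(1) by (auto simp: y'_def Y_def)
          have "slt x' y'"
            using xy(3) x' y' slt_insert_iff[of x' y' i] fin by simp
          moreover have "y' \<in> B"
            using xy(2) insert_mem_glue[OF sub y'(2)] unfolding AB(3) y'(1) by simp
          ultimately have "x' \<in> B" using initialD[OF AB(2)] x'(2) by blast
          then show ?thesis
            using insert_mem_glue[OF sub x'(2)] unfolding AB(3) x'(1) by simp
        qed
      qed
    next
      case False
      then obtain i where i: "i \<in> X"
        and ni: "\<And>A B. initial (X - {i}) A \<Longrightarrow> initial (X - {i}) B \<Longrightarrow> S \<noteq> glue i A B" by meson
      define Y where "Y = X - {i}"
      have Y: "finite Y" "i \<notin> Y" "X = insert i Y" "Y \<subset> X"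
        using i psubset.hyps by (auto simp: Y_def)
      obtain A B where AB: "A \<subseteq> Pow Y" "B \<subseteq> Pow Y" "S = glue i A B"
        using ex_glue less.prems(1) Y(3) by metis
      have "card A \<le> card (Pow Y)" "card B \<le> card (Pow Y)"
        using AB Y by (meson card_mono finite_Pow_iff)+
      then obtain A' B' where A': "initial Y A'" "card A' = card A"
        and B': "initial Y B'" "card B' = card B"
        using ex_initial_card[OF Y(1) initial_Pow] by metis
      have sub: "A' \<subseteq> Pow Y" "B' \<subseteq> Pow Y" using A' B' initial_subset by blast+
      let ?S = "glue i A' B'"
      have ne: "A \<noteq> A' \<or> B \<noteq> B'" using ni A' B' AB by (auto simp: Y_def)
      have mA: "rk x < rk y" and mB: "rk (insert i x) < rk (insert i y)"
        if "x \<subseteq> Y" "y \<subseteq> Y" "slt x y" for x y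
      proof -
        have "finite x" "finite y" using that Y(1) finite_subset by blast+
        then have "slt (insert i x) (insert i y)"
          using that Y slt_insert_iff[of x y i] by blast
        then show "rk x < rk y" "rk (insert i x) < rk (insert i y)"
          using rk[of x y] rk[of "insert i x" "insert i y"] that Y by blast+
      qed
      note lA = sum_initial_le[OF Y(1) A'(1) AB(1) A'(2)[symmetric], of rk]
      note lB = sum_initial_le[OF Y(1) B'(1) AB(2) B'(2)[symmetric], of "\<lambda>x. rk (insert i x)"]
      have "sum rk ?S < sum rk S"
        using ne lA lB mA mB unfolding AB(3) sum_glue[OF Y(1,2) sub] sum_glue[OF Y(1,2) AB(1,2)]
        by (metis (no_types, lifting) add_le_less_mono add_less_le_mono)
      moreover have "card ?S = card S"
        using A' B' by (simp add: AB(3) card_glue[OF Y(1,2)] sub AB(1,2))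
      moreover have "?S \<subseteq> Pow X" using glue_subset[OF sub, of i] Y(3) by simp
      ultimately have "card (nb X I) \<le> card (nb X ?S)"
        using less.hyps less.prems by simp
      also have "\<dots> \<le> card (nb X S)"
        unfolding Y(3) AB(3)
        using psubset.IH[OF Y(4)] A' B' AB
        by (intro card_nb_glue_initial_le[OF Y(1,2)]) auto
      finally show ?thesis .
    qed
  qed
qed

section \<open>The largest boundary of an initial segment\<close>

text \<open>The bound is strict: \<open>ball X r\<close> consists of the layers of sizes
  \<open>0\<close> to \<open>r - 1\<close>, and \<open>ball X 0\<close> is empty.\<close>

definition ball :: "'a set \<Rightarrow> nat \<Rightarrow> 'a set set" where
  "ball X r = {x \<in> Pow X. card x < r}"

lemma ball_subset: "ball X r \<subseteq> Pow X"
  by (auto simp: ball_def)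

lemma initial_ball: "initial X (ball X r)"
  unfolding initial_def ball_def by (auto dest!: slt_card_le)

lemma card_ball_Suc:
  assumes "finite X"
  shows "card (ball X (Suc r)) = card (ball X r) + (card X choose r)"
proof -
  have "ball X (Suc r) = ball X r \<union> {x. x \<subseteq> X \<and> card x = r}"
    by (auto simp: ball_def)
  moreover have "ball X r \<inter> {x. x \<subseteq> X \<and> card x = r} = {}"
    by (auto simp: ball_def)
  moreover have "finite (ball X r)" "finite {x. x \<subseteq> X \<and> card x = r}"
    using assms by (auto simp: ball_def)
  ultimately show ?thesis
    using assms by (simp add: card_Un_disjoint n_subsets)
qed

lemma near_card_le:
  assumes "finite u" "near u v"
  shows "card v \<le> Suc (card u)"
  using assms unfolding near_def
  by (metis card_insert_le_m1 card_insert_if card_mono finite_insert le_SucI order_refl subset_insertI)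

lemma nb_ball_subset:
  assumes "finite X"
  shows "nb X (ball X r) \<subseteq> ball X (Suc r)"
proof
  fix v assume "v \<in> nb X (ball X r)"
  then obtain u where "u \<subseteq> X" "card u < r" "near u v" "v \<subseteq> X"
    by (auto simp: nb_def ball_def)
  moreover from this have "card v \<le> Suc (card u)"
    using near_card_le finite_subset[OF _ assms] by blast
  ultimately show "v \<in> ball X (Suc r)" by (simp add: ball_def)
qed

text \<open>A nonempty \<open>v\<close> reaches \<open>ball X r\<close> by losing an element. The
  empty set has none to lose, but it is the first set in the order and so belongs to every nonempty
  initial segment.\<close>

lemma ball_Suc_subset_nb:
  assumes "finite X" "initial X B" "ball X r \<subseteq> B" "B \<noteq> {}"
  shows "ball X (Suc r) \<subseteq> nb X B"
proof
  fix v assume v: "v \<in> ball X (Suc r)"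
  then have fin: "finite v" using assms(1) by (auto simp: ball_def intro: finite_subset)
  show "v \<in> nb X B"
  proof (cases "v = {}")
    case True
    obtain u where u: "u \<in> B" "u \<subseteq> X" using assms(4) initial_subset[OF assms(2)] by auto
    have "{} \<in> B"
    proof (cases "u = {}")
      case False
      then have "slt {} u" using u finite_subset[OF u(2) assms(1)] by (auto intro!: slt_psubset)
      then show ?thesis using initialD[OF assms(2) u(1)] by simp
    qed (use u in simp)
    then show ?thesis using True subset_nb[OF initial_subset[OF assms(2)]] by blast
  next
    case False
    then obtain j where j: "j \<in> v" by auto
    have "card (v - {j}) < card v" by (rule card_Diff1_less[OF fin j])
    then have "v - {j} \<in> B" using v assms(3) by (auto simp: ball_def)
    then show ?thesis using near_remove[of v j] v by (auto simp: nb_def ball_def)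
  qed
qed

text \<open>Within a layer, sets containing the least element \<open>a\<close> come first: for equal
  sizes the first difference would lie in \<open>x\<close>, hence above \<open>a\<close>, where
  agreement below it would force \<open>a\<close> into \<open>x\<close>.\<close>

lemma slt_insert_Min:
  assumes "\<forall>b\<in>Y. a < b" "x \<subseteq> Y" "slt x (insert a y)"
  shows "card x < card (insert a y)"
proof (rule ccontr)
  assume "\<not> ?thesis"
  then obtain m where m: "m \<in> x" "x \<inter> {..<m} = insert a y \<inter> {..<m}"
    using assms(3) unfolding slt_def by blast
  then have "a < m" using assms by blast
  then have "a \<in> x" using m by blast
  then show False using assms by blast
qed

text \<open>Within each layer the sets containing the minimum \<open>a\<close> come first. The two
  alternatives in \<open>cross\<close> say whether the segment stops inside the part of layer
  \<open>r\<close> that contains \<open>a\<close>, or inside the part that avoids it.\<close>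

lemma initial_glue:
  assumes "finite Y" "\<forall>b\<in>Y. a < b" "initial Y A" "initial Y B"
    and A: "ball Y r \<subseteq> A"
    and B: "B \<subseteq> ball Y r"
    and cross: "A \<subseteq> ball Y r \<and> ball Y (r - 1) \<subseteq> B \<or> A \<subseteq> ball Y (Suc r) \<and> B = ball Y r"
  shows "initial (insert a Y) (glue a A B)"
  unfolding initial_def
proof (intro conjI ballI impI)
  have aY: "a \<notin> Y" using assms(2) by blast
  have sub: "A \<subseteq> Pow Y" "B \<subseteq> Pow Y" using assms initial_subset by blast+
  show "glue a A B \<subseteq> Pow (insert a Y)" by (rule glue_subset[OF sub])
  fix y x assume y: "y \<in> glue a A B" and x: "x \<in> Pow (insert a Y)" and lt: "slt x y"
  have fin: "finite u" if "u \<subseteq> Y" for u using that assms(1) finite_subset by blast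
  have "(\<exists>y'\<in>B. y = insert a y') \<or> y \<in> A"
    using y by (auto simp: glue_def)
  moreover have "(\<exists>x'\<subseteq>Y. x = insert a x') \<or> x \<subseteq> Y"
    using x by (metis Pow_iff insert_Diff subset_insert subset_insert_iff)
  ultimately consider
      (ii) x' y' where "x' \<subseteq> Y" "x = insert a x'" "y' \<in> B" "y = insert a y'"
    | (io) x' where "x' \<subseteq> Y" "x = insert a x'" "y \<in> A"
    | (oi) y' where "x \<subseteq> Y" "y' \<in> B" "y = insert a y'"
    | (oo) "x \<subseteq> Y" "y \<in> A"
    by blast
  then show "x \<in> glue a A B"
  proof cases
    case ii
    have y': "y' \<subseteq> Y" using ii sub by blast
    have "a \<notin> x'" "a \<notin> y'" using ii(1) y' aY by blast+
    then have "slt x' y'"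
      using lt ii slt_insert_iff[of x' y' a] fin y' by simp
    then show ?thesis using initialD[OF assms(4) ii(3,1)] ii by (simp add: glue_def)
  next
    case io
    have "a \<notin> x'" using io aY by blast
    then have "Suc (card x') \<le> card y" using slt_card_le[OF lt] io fin[OF io(1)] by simp
    then have "x' \<in> B" using cross io by (fastforce simp: ball_def)
    then show ?thesis using io by (simp add: glue_def)
  next
    case oi
    have y': "card y' < r" "y' \<subseteq> Y" using oi B by (auto simp: ball_def)
    have "card x < card (insert a y')" using slt_insert_Min[OF assms(2) oi(1)] lt oi by blast
    then have "card x < r" using y' fin[OF y'(2)] card_insert_le_m1[of r y' a] by linarith
    then show ?thesis using oi A by (auto simp: ball_def glue_def)
  next
    case oo
    then show ?thesis using initialD[OF assms(3) oo(2,1) lt] by (simp add: glue_def)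
  qed
qed

section \<open>The extremal boundary size\<close>

text \<open>Each summand is the largest binomial coefficient of its row. The value is the largest
  possible growth from \<open>I\<close> to \<open>nb X I\<close> over initial segments
  \<open>I\<close> when \<open>card X = d\<close>.\<close>

definition bdry :: "nat \<Rightarrow> nat" where
  "bdry d = (\<Sum>i<d. i choose (i div 2))"

text \<open>Induction by adding a new minimum \<open>a\<close>. One slice of \<open>I\<close> is an
  exact ball, the other an arbitrary initial segment. The half governed by the ball gains at most
  one layer, so at most a middle binomial coefficient; the other half gains at most the inductive
  bound.\<close>

lemma card_nb_initial_upper:
  assumes "finite X" "initial X I"
  shows "card (nb X I) \<le> card I + bdry (card X)"
  using assms
proof (induction X arbitrary: I rule: finite_linorder_min_induct)
  case empty
  then have "nb {} I \<subseteq> I" by (auto simp: nb_def initial_def near_def)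
  then show ?case using initial_finite[OF _ empty] card_mono[of I "nb {} I"] by (simp add: trans_le_add1)
next
  case (insert a Y)
  note fin = insert.hyps(1)
  have aY: "a \<notin> Y" using insert.hyps by blast
  have finY: "finite u" if "u \<subseteq> Y" for u using that fin finite_subset by blast
  obtain A B where AB: "A \<subseteq> Pow Y" "B \<subseteq> Pow Y" "I = glue a A B"
    using ex_glue[OF initial_subset[OF insert.prems]] by blast
  note memA = mem_glue[OF aY AB(1,2)] and memB = insert_mem_glue[OF aY AB(1,2)]
  have iA: "initial Y A"
    unfolding initial_def
  proof (intro conjI ballI impI)
    fix y x assume "y \<in> A" "x \<in> Pow Y" "slt x y"
    moreover from this have "y \<subseteq> Y" using AB by blast
    ultimately show "x \<in> A"
      using initialD[OF insert.prems, of y x] memA unfolding AB(3) by blast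
  qed (rule AB)
  have iB: "initial Y B"
    unfolding initial_def
  proof (intro conjI ballI impI)
    fix y x assume *: "y \<in> B" "x \<in> Pow Y" "slt x y"
    then have "y \<subseteq> Y" using AB by blast
    then have "slt (insert a x) (insert a y)"
      using * slt_insert_iff[of x y a] finY aY by auto
    then show "x \<in> B"
      using initialD[OF insert.prems, of "insert a y" "insert a x"] memB * \<open>y \<subseteq> Y\<close>
      unfolding AB(3) by blast
  qed (rule AB)
  have c: "card (insert a Y) = Suc (card Y)" using fin aY by simp
  have subs: "nb Y A \<union> B \<subseteq> Pow Y" "nb Y B \<union> A \<subseteq> Pow Y"
    using AB nb_subset[of Y] by blast+
  have cI: "card I = card A + card B"
    unfolding AB(3) by (rule card_glue[OF fin aY AB(1,2)])
  have cN: "card (nb (insert a Y) I) = card (nb Y A \<union> B) + card (nb Y B \<union> A)"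
    unfolding AB(3) nb_glue[OF aY AB(1,2)] by (rule card_glue[OF fin aY subs])
  have finb: "finite (ball Y r)" for r using fin by (simp add: ball_def)
  have top: "card Y choose r \<le> card Y choose (card Y div 2)" for r
    by (rule binomial_maximum)
  have bd: "bdry (Suc (card Y)) = bdry (card Y) + (card Y choose (card Y div 2))"
    by (simp add: bdry_def)
  show ?case
  proof (cases "I = {}")
    case True
    then show ?thesis by (simp add: nb_def)
  next
    case False
    then obtain y where y: "y \<in> I" "\<And>x. x \<in> I \<Longrightarrow> x \<noteq> y \<Longrightarrow> slt x y"
      using ex_slt_max[OF _ initial_subset[OF insert.prems]] fin by auto
    have below: "x \<in> I" if "x \<subseteq> insert a Y" "slt x y" for x
      using initialD[OF insert.prems y(1)] that by blast
    have above: "x = y \<or> slt x y" if "x \<in> I" for x using y that by blast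
    show ?thesis
    \<comment> \<open>The last set \<open>y\<close> shows where the segment stops in its layer. If
      \<open>a\<close> is in \<open>y\<close>, the slice \<open>A\<close> is the full ball;
      otherwise \<open>B\<close> is. The remaining slice lies between consecutive balls, so each
      half of the neighbourhood is controlled by a single slice.\<close>
    proof (cases "a \<in> y")
      case True
      define y' where "y' = y - {a}"
      have y': "y = insert a y'" "y' \<subseteq> Y" "a \<notin> y'"
        using True y initial_subset[OF insert.prems] by (auto simp: y'_def)
      define r where "r = card y"
      have r: "r = Suc (card y')" using y' finY by (simp add: r_def)
      have "A = ball Y r"
      proof
        show "A \<subseteq> ball Y r"
        proof
          fix x assume x: "x \<in> A"
          then have "x \<subseteq> Y" "x \<in> I" using AB(1) by (auto simp: AB(3) glue_def)
          moreover from this have "slt x y" using above True aY by blast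
          ultimately show "x \<in> ball Y r"
            using slt_insert_Min[OF insert.hyps(2)] y' by (auto simp: ball_def r_def)
        qed
        show "ball Y r \<subseteq> A"
          using below memA by (auto simp: ball_def r_def AB(3) slt_def)
      qed
      moreover have "ball Y (r - 1) \<subseteq> B"
      proof
        fix x assume x: "x \<in> ball Y (r - 1)"
        then have "x \<subseteq> Y" "a \<notin> x" using aY by (auto simp: ball_def)
        then have "card (insert a x) < card y" using x finY by (simp add: ball_def r_def)
        then have "insert a x \<in> I" using below[of "insert a x"] \<open>x \<subseteq> Y\<close>
          by (auto simp: slt_def)
        then show "x \<in> B" using memB \<open>x \<subseteq> Y\<close> unfolding AB(3) by blast
      qed
      moreover have "y' \<in> B" using memB[OF y'(2)] y(1) unfolding AB(3) y'(1) by simp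
      moreover have "B \<subseteq> ball Y r"
      proof
        fix x assume x: "x \<in> B"
        then have "x \<subseteq> Y" using AB by blast
        have "insert a x \<in> I" using x by (auto simp: AB(3) glue_def)
        then have "card (insert a x) \<le> r" using above slt_card_le r_def by blast
        moreover have "a \<notin> x" using \<open>x \<subseteq> Y\<close> aY by blast
        ultimately show "x \<in> ball Y r" using \<open>x \<subseteq> Y\<close> finY[of x] by (simp add: ball_def)
      qed
      ultimately have "nb Y A \<union> B \<subseteq> ball Y (Suc r)" "nb Y B \<union> A = nb Y B"
        using nb_ball_subset[OF fin, of r] ball_Suc_subset_nb[OF fin iB, of "r - 1"] r
        by (auto simp: ball_def)
      then have "card (nb Y A \<union> B) \<le> card (ball Y (Suc r))" "card (nb Y B \<union> A) = card (nb Y B)"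
        using finb by (auto intro: card_mono)
      then show ?thesis
        using insert.IH[OF iB] card_ball_Suc[OF fin, of r] top[of r] \<open>A = ball Y r\<close> cI cN bd c
        by simp
    next
      case False
      define r where "r = card y"
      have yY: "y \<subseteq> Y" using False y initial_subset[OF insert.prems] by blast
      have "y \<in> A" using memA[OF yY] y(1) AB(3) by simp
      have "B = ball Y r"
      proof
        show "B \<subseteq> ball Y r"
        proof
          fix x assume x: "x \<in> B"
          then have "x \<subseteq> Y" using AB by blast
          have "insert a x \<in> I" using x by (auto simp: AB(3) glue_def)
          then have "card (insert a x) \<le> r" using above slt_card_le r_def by blast
          moreover have "a \<notin> x" using \<open>x \<subseteq> Y\<close> aY by blast
          ultimately show "x \<in> ball Y r" using \<open>x \<subseteq> Y\<close> finY[of x] by (simp add: ball_def)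
        qed
        show "ball Y r \<subseteq> B"
        proof
          fix x assume x: "x \<in> ball Y r"
          then have xY: "x \<subseteq> Y" "a \<notin> x" using aY by (auto simp: ball_def)
          then have "card (insert a x) \<le> card y" using x finY by (simp add: ball_def r_def)
          moreover have "a \<in> insert a x - y" "insert a x \<inter> {..<a} = y \<inter> {..<a}"
            using False xY yY insert.hyps(2) by fastforce+
          ultimately have "slt (insert a x) y"
            unfolding slt_def by (metis le_neq_implies_less)
          then have "insert a x \<in> I" using below[of "insert a x"] xY by blast
          then show "x \<in> B" using memB xY unfolding AB(3) by blast
        qed
      qed
      moreover have "ball Y r \<subseteq> A"
        using below memA by (auto simp: ball_def r_def AB(3) slt_def)
      moreover have "A \<subseteq> ball Y (Suc r)"
      proof
        fix x assume x: "x \<in> A"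
        then have "x \<subseteq> Y" "x \<in> I" using AB(1) by (auto simp: AB(3) glue_def)
        then show "x \<in> ball Y (Suc r)" using above slt_card_le by (fastforce simp: ball_def r_def)
      qed
      moreover have "A \<subseteq> nb Y A" by (rule subset_nb[OF AB(1)])
      ultimately have "nb Y A \<union> B = nb Y A" "nb Y B \<union> A \<subseteq> ball Y (Suc r)"
        using nb_ball_subset[OF fin, of r] by blast+
      then have "card (nb Y B \<union> A) \<le> card (ball Y (Suc r))" "card (nb Y A \<union> B) = card (nb Y A)"
        using finb by (auto intro: card_mono)
      then show ?thesis
        using insert.IH[OF iA] card_ball_Suc[OF fin, of r] top[of r] \<open>B = ball Y r\<close> cI cN bd c
        by simp
    qed
  qed
qed

text \<open>Builds a segment for which every estimate of the upper bound is tight. Confining it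
  between consecutive balls is what lets the induction glue it to a ball whose next layer is the
  middle one.\<close>

lemma ex_card_nb_initial_lower:
  fixes X :: "'a::linorder set"
  assumes "finite X" and "r = (card X - 1) div 2"
  shows "\<exists>I. initial X I \<and> I \<noteq> {} \<and> ball X r \<subseteq> I \<and> I \<subseteq> ball X (Suc r) \<and>
    card I + bdry (card X) \<le> card (nb X I)"
  using assms
proof (induction X arbitrary: r rule: finite_linorder_min_induct)
  case empty
  have "initial ({} :: 'a set) {{}}" by (simp add: initial_def)
  moreover have "nb ({} :: 'a set) {{}} = {{}}" by (auto simp: nb_def near_def)
  ultimately show ?case
    using empty by (intro exI[of _ "{{}}"]) (simp add: ball_def bdry_def)
next
  case (insert a Y)
  note fin = insert.hyps(1)
  have aY: "a \<notin> Y" using insert.hyps by blast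
  have r: "r = card Y div 2" using insert.prems fin aY by simp
  define s where "s = (card Y - 1) div 2"
  obtain J where J: "initial Y J" "J \<noteq> {}" "ball Y s \<subseteq> J" "J \<subseteq> ball Y (Suc s)"
    "card J + bdry (card Y) \<le> card (nb Y J)"
    using insert.IH[OF s_def] by blast
  have JY: "J \<subseteq> Pow Y" by (rule initial_subset[OF J(1)])
  have bd: "bdry (card (insert a Y)) = bdry (card Y) + (card Y choose r)"
    using fin aY by (simp add: bdry_def r)
  have grow: "ball Y (Suc k) \<subseteq> nb Y (ball Y k)" if "k > 0" for k
    using that by (intro ball_Suc_subset_nb[OF fin initial_ball]) (auto simp: ball_def)
  have finN: "finite (nb Y S \<union> T)" if "T \<subseteq> Pow Y" for S T
    using nb_finite[OF fin] that fin by (meson finite_Pow_iff finite_UnI finite_subset)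
  have sz: "card (glue a A B) + bdry (card (insert a Y)) \<le> card (nb (insert a Y) (glue a A B))"
    if "A \<subseteq> Pow Y" "B \<subseteq> Pow Y"
      "card A + card B + bdry (card Y) + (card Y choose r) \<le> card (nb Y A \<union> B) + card (nb Y B \<union> A)" for A B
  proof -
    have "nb Y A \<union> B \<subseteq> Pow Y" "nb Y B \<union> A \<subseteq> Pow Y"
      using that nb_subset[of Y] by blast+
    then show ?thesis
      using that by (simp add: nb_glue[OF aY] card_glue[OF fin aY] bd)
  qed
  have binb: "ball (insert a Y) k \<subseteq> glue a A B"
    if "ball Y k \<subseteq> A" "ball Y (k - 1) \<subseteq> B" for k A B
  proof
    fix x assume x: "x \<in> ball (insert a Y) k"
    show "x \<in> glue a A B"
    proof (cases "a \<in> x")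
      case True
      then have e: "x = insert a (x - {a})" "x - {a} \<subseteq> Y" using x by (auto simp: ball_def)
      have "finite x" using x fin by (auto simp: ball_def intro: finite_subset)
      then have "card x = Suc (card (x - {a}))" using True by (rule card.remove)
      moreover have "card x < k" using x by (simp add: ball_def)
      ultimately have "card (x - {a}) < k - 1" by linarith
      then have "x - {a} \<in> ball Y (k - 1)" using e(2) by (simp add: ball_def)
      then show ?thesis using that(2) e(1) unfolding glue_def by blast
    next
      case False
      then show ?thesis using x that(1) by (auto simp: ball_def glue_def)
    qed
  qed
  have bout: "glue a A B \<subseteq> ball (insert a Y) (Suc k)"
    if "A \<subseteq> ball Y (Suc k)" "B \<subseteq> ball Y k" for k A B
  proof
    fix x assume "x \<in> glue a A B"
    then consider "x \<in> A" | z where "z \<in> B" "x = insert a z"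
      by (auto simp: glue_def)
    then show "x \<in> ball (insert a Y) (Suc k)"
    proof cases
      case 1
      then show ?thesis using that(1) by (auto simp: ball_def)
    next
      case (2 z)
      then have z: "z \<subseteq> Y" "card z < k" using that(2) by (auto simp: ball_def)
      then have "card (insert a z) = Suc (card z)"
        using aY finite_subset[OF z(1) fin] by (meson card_insert_disjoint subsetD)
      then show ?thesis using z 2 by (auto simp: ball_def)
    qed
  qed
  show ?case
  \<comment> \<open>The slice \<open>ball Y r\<close> must gain layer \<open>card Y div 2\<close>,
    the middle one. If \<open>s = r\<close>, then \<open>J\<close> fits as the slice avoiding
    \<open>a\<close>; if \<open>r = Suc s\<close>, the roles are exchanged and \<open>J\<close>
    becomes the slice containing \<open>a\<close>.\<close>
  proof (cases "s = r")
    case True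
    let ?I = "glue a J (ball Y r)"
    have "initial (insert a Y) ?I"
      using J True by (intro initial_glue[OF fin insert.hyps(2) J(1) initial_ball]) auto
    moreover have "?I \<noteq> {}" using J(2) by (simp add: glue_def)
    moreover have "ball (insert a Y) r \<subseteq> ?I"
      using J True by (intro binb) (auto simp: ball_def)
    moreover have "?I \<subseteq> ball (insert a Y) (Suc r)"
      using J True by (intro bout) auto
    moreover have "card ?I + bdry (card (insert a Y)) \<le> card (nb (insert a Y) ?I)"
    proof (rule sz[OF JY ball_subset])
      have "ball Y (Suc r) \<subseteq> nb Y (ball Y r) \<union> J"
      \<comment> \<open>An empty ball has no neighbours; here the layer consisting of the empty set
        is supplied by \<open>J\<close>.\<close>
      proof (cases "r = 0")
        case True
        then have "ball Y (Suc r) = {{}}"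
          using fin by (auto simp: ball_def dest: finite_subset)
        then show ?thesis using J \<open>s = r\<close> by auto
      qed (use grow in blast)
      then have "card (ball Y (Suc r)) \<le> card (nb Y (ball Y r) \<union> J)"
        by (intro card_mono finN JY)
      moreover have "card (nb Y J) \<le> card (nb Y J \<union> ball Y r)"
        by (intro card_mono finN ball_subset) auto
      ultimately show "card J + card (ball Y r) + bdry (card Y) + (card Y choose r)
          \<le> card (nb Y J \<union> ball Y r) + card (nb Y (ball Y r) \<union> J)"
        using J(5) card_ball_Suc[OF fin, of r] by linarith
    qed
    ultimately show ?thesis by blast
  next
    case False
    moreover have "k div 2 = (k - 1) div 2 \<or> k div 2 = Suc ((k - 1) div 2)" for k :: nat
      by presburger
    ultimately have rs: "r = Suc s" unfolding r s_def by metis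
    let ?I = "glue a (ball Y r) J"
    have "initial (insert a Y) ?I"
      using J rs by (intro initial_glue[OF fin insert.hyps(2) initial_ball J(1)]) auto
    moreover have "?I \<noteq> {}" using J(2) by (simp add: glue_def)
    moreover have "ball (insert a Y) r \<subseteq> ?I"
      using J rs by (intro binb) auto
    moreover have "?I \<subseteq> ball (insert a Y) (Suc r)"
      using J rs by (intro bout) (auto simp: ball_def)
    moreover have "card ?I + bdry (card (insert a Y)) \<le> card (nb (insert a Y) ?I)"
    proof (rule sz[OF ball_subset JY])
      have "card (ball Y (Suc r)) \<le> card (nb Y (ball Y r) \<union> J)"
        using grow[of r] rs by (intro card_mono finN JY) auto
      moreover have "card (nb Y J) \<le> card (nb Y J \<union> ball Y r)"
        by (intro card_mono finN ball_subset) auto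
      ultimately show "card (ball Y r) + card J + bdry (card Y) + (card Y choose r)
          \<le> card (nb Y (ball Y r) \<union> J) + card (nb Y J \<union> ball Y r)"
        using J(5) card_ball_Suc[OF fin, of r] by linarith
    qed
    ultimately show ?thesis by blast
  qed
qed

section \<open>The game on the hypercube\<close>

text \<open>For \<open>x\<close> within \<open>{1..n-1}\<close>, the vertex of parity
  \<open>p\<close> (\<open>True\<close> for odd) that becomes \<open>x\<close> when \<open>n\<close>
  is deleted; \<open>n\<close> serves as a parity bit.\<close>

definition lift :: "nat \<Rightarrow> bool \<Rightarrow> nat set \<Rightarrow> nat set" where
  "lift n p x = (if odd (card x) = p then x else insert n x)"

lemma card_sym_diff_eq_1_iff:
  "card (sym_diff u v) = 1 \<longleftrightarrow> (\<exists>j. j \<notin> u \<and> v = insert j u \<or> j \<notin> v \<and> u = insert j v)"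
proof
  assume "card (sym_diff u v) = 1"
  then obtain j where "sym_diff u v = {j}" by (auto simp: card_1_singleton_iff)
  then have j: "j \<in> u \<longleftrightarrow> j \<notin> v" and j': "\<And>k. k \<noteq> j \<Longrightarrow> k \<in> u \<longleftrightarrow> k \<in> v"
    by blast+
  show "\<exists>j. j \<notin> u \<and> v = insert j u \<or> j \<notin> v \<and> u = insert j v"
  proof (cases "j \<in> u")
    case True
    then have "j \<notin> v \<and> u = insert j v" using j j' by (metis insert_iff subsetI subset_antisym)
    then show ?thesis by blast
  next
    case False
    then have "v = insert j u" using j j' by (metis insert_iff subsetI subset_antisym)
    then show ?thesis using False by blast
  qed
next
  assume "\<exists>j. j \<notin> u \<and> v = insert j u \<or> j \<notin> v \<and> u = insert j v"
  then obtain j where "sym_diff u v = {j}" by (auto simp: insert_Diff_if)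
  then show "card (sym_diff u v) = 1" by simp
qed

lemma nbhd_Un: "nbhd G (S \<union> T) = nbhd G S \<union> nbhd G T"
  by (auto simp: nbhd_def)

lemma nbhd_mono: "S \<subseteq> T \<Longrightarrow> nbhd G S \<subseteq> nbhd G T"
  by (auto simp: nbhd_def)

context
  fixes d :: nat
  notes One_nat_def [simp del]
begin

abbreviation "Q \<equiv> hypercube (Suc d)"
abbreviation "V \<equiv> {1..d}"

lemma fin_V: "finite V" by simp

lemma
  assumes "x \<subseteq> V"
  shows lift_Diff: "lift (Suc d) p x - {Suc d} = x"
    and odd_card_lift: "odd (card (lift (Suc d) p x)) = p"
    and lift_in: "lift (Suc d) p x \<in> pverts Q"
proof -
  have "Suc d \<notin> x" "finite x" using assms by (auto intro: finite_subset)
  then show "lift (Suc d) p x - {Suc d} = x" "odd (card (lift (Suc d) p x)) = p"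
    by (auto simp: lift_def)
  have "V \<subseteq> {1..Suc d}" by auto
  then show "lift (Suc d) p x \<in> pverts Q"
    using assms by (auto simp: lift_def hypercube_def)
qed

lemma inj_on_lift:
  assumes "S \<subseteq> Pow V"
  shows "inj_on (lift (Suc d) p) S"
proof (rule inj_onI)
  fix x y assume "x \<in> S" "y \<in> S" and eq: "lift (Suc d) p x = lift (Suc d) p y"
  then have "x \<subseteq> V" "y \<subseteq> V" using assms by auto
  from lift_Diff[OF this(1), of p] lift_Diff[OF this(2), of p] show "x = y"
    unfolding eq by simp
qed

lemma lift_surj:
  assumes "v \<in> pverts Q"
  shows "v - {Suc d} \<subseteq> V" "v = lift (Suc d) (odd (card v)) (v - {Suc d})"
proof -
  have v: "v \<subseteq> {1..Suc d}" using assms by (simp add: hypercube_def)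
  then show "v - {Suc d} \<subseteq> V" by (auto simp: atLeastAtMostSuc_conv)
  have "finite v" using v finite_subset by blast
  show "v = lift (Suc d) (odd (card v)) (v - {Suc d})"
  proof (cases "Suc d \<in> v")
    case True
    then have "card v = Suc (card (v - {Suc d}))" using \<open>finite v\<close> by (intro card.remove)
    then show ?thesis using True by (auto simp: lift_def)
  qed (simp add: lift_def)
qed

lemma pverts_eq: "pverts Q = lift (Suc d) True ` Pow V \<union> lift (Suc d) False ` Pow V"
proof
  show "pverts Q \<subseteq> lift (Suc d) True ` Pow V \<union> lift (Suc d) False ` Pow V"
  proof
    fix v assume v: "v \<in> pverts Q"
    then show "v \<in> lift (Suc d) True ` Pow V \<union> lift (Suc d) False ` Pow V"
      using lift_surj[OF v] by (cases "odd (card v)") auto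
  qed
qed (auto intro: lift_in)

lemma lift_insert:
  assumes "x \<subseteq> V" "j \<in> V" "j \<notin> x"
  shows "lift (Suc d) (\<not> p) (insert j x) = insert j (lift (Suc d) p x)" "j \<notin> lift (Suc d) p x"
proof -
  have "finite x" "j \<noteq> Suc d" using assms finite_subset[OF assms(1)] by auto
  then show "lift (Suc d) (\<not> p) (insert j x) = insert j (lift (Suc d) p x)" "j \<notin> lift (Suc d) p x"
    using assms by (auto simp: lift_def)
qed

text \<open>An edge always flips the parity. After deleting \<open>Suc d\<close>, its ends coincide
  if the edge toggles \<open>Suc d\<close>, and otherwise still differ in one element; hence closed
  neighbourhoods.\<close>

lemma arc_lift_iff:
  assumes x: "x \<subseteq> V" and y: "y \<subseteq> V"
  shows "(lift (Suc d) p x, lift (Suc d) q y) \<in> parcs Q \<longleftrightarrow> q = (\<not> p) \<and> near x y"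
proof -
  let ?u = "lift (Suc d) p x" and ?v = "lift (Suc d) q y"
  have "?u \<in> pverts Q" "?v \<in> pverts Q" using lift_in x y by auto
  then have fin: "finite ?u" "finite ?v"
    by (auto simp: hypercube_def intro: finite_subset)
  have flip: "(odd (card w) = (\<not> odd (card u))) \<and> (w - {m} = u - {m} \<or> w - {m} = insert j (u - {m}))"
    if "finite u" "j \<notin> u" "w = insert j u" for w u :: "nat set" and j m
    using that by auto
  note odd = odd_card_lift[OF x, of p] odd_card_lift[OF y, of q]
  have "card (sym_diff ?u ?v) = 1 \<longleftrightarrow> q = (\<not> p) \<and> near x y"
  proof
    assume "card (sym_diff ?u ?v) = 1"
    then obtain j where "j \<notin> ?u \<and> ?v = insert j ?u \<or> j \<notin> ?v \<and> ?u = insert j ?v"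
      unfolding card_sym_diff_eq_1_iff by blast
    then show "q = (\<not> p) \<and> near x y"
    proof
      assume "j \<notin> ?u \<and> ?v = insert j ?u"
      then show ?thesis
        using flip[OF fin(1), of j ?v "Suc d"] odd
        unfolding lift_Diff[OF x] lift_Diff[OF y] near_def by metis
    next
      assume "j \<notin> ?v \<and> ?u = insert j ?v"
      then show ?thesis
        using flip[OF fin(2), of j ?u "Suc d"] odd
        unfolding lift_Diff[OF x] lift_Diff[OF y] near_def by metis
    qed
  next
    assume qn: "q = (\<not> p) \<and> near x y"
    have "\<exists>j. j \<notin> ?u \<and> ?v = insert j ?u \<or> j \<notin> ?v \<and> ?u = insert j ?v"
    proof (cases "x = y")
      case True
      have "Suc d \<notin> x" using x by auto
      then show ?thesis using qn True by (auto simp: lift_def)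
    next
      case False
      then obtain j where "y = insert j x \<and> j \<notin> x \<or> x = insert j y \<and> j \<notin> y"
        using qn unfolding near_def by (metis insert_absorb)
      then show ?thesis
      proof
        assume "y = insert j x \<and> j \<notin> x"
        then show ?thesis using lift_insert[OF x, of j p] y qn by (intro exI[of _ j]) auto
      next
        assume "x = insert j y \<and> j \<notin> y"
        then show ?thesis using lift_insert[OF y, of j q] x qn by (intro exI[of _ j]) auto
      qed
    qed
    then show "card (sym_diff ?u ?v) = 1" unfolding card_sym_diff_eq_1_iff .
  qed
  then show ?thesis
    using \<open>?u \<in> pverts Q\<close> \<open>?v \<in> pverts Q\<close> by (simp add: hypercube_def)
qed

lemma nbhd_lift:
  assumes "S \<subseteq> Pow V"
  shows "nbhd Q (lift (Suc d) p ` S) = lift (Suc d) (\<not> p) ` nb V S"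
proof (intro subset_antisym subsetI)
  fix v assume "v \<in> nbhd Q (lift (Suc d) p ` S)"
  then obtain x where x: "x \<in> S" "(lift (Suc d) p x, v) \<in> parcs Q" "v \<in> pverts Q"
    by (auto simp: nbhd_def)
  define y where "y = v - {Suc d}"
  have y: "y \<subseteq> V" "v = lift (Suc d) (odd (card v)) y"
    using lift_surj[OF x(3)] by (simp_all add: y_def)
  have "x \<subseteq> V" using x assms by auto
  then have "odd (card v) = (\<not> p) \<and> near x y"
    using x(2) y arc_lift_iff[of x y p "odd (card v)"] by simp
  then show "v \<in> lift (Suc d) (\<not> p) ` nb V S"
    using x y by (auto simp: nb_def)
next
  fix v assume "v \<in> lift (Suc d) (\<not> p) ` nb V S"
  then obtain x y where xy: "x \<in> S" "near x y" "y \<subseteq> V" "v = lift (Suc d) (\<not> p) y"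
    by (auto simp: nb_def)
  then have "x \<subseteq> V" using assms by auto
  then have "(lift (Suc d) p x, v) \<in> parcs Q" using arc_lift_iff xy by simp
  then show "v \<in> nbhd Q (lift (Suc d) p ` S)"
    using xy lift_in by (auto simp: nbhd_def)
qed

section \<open>The lower bound: too few hunters\<close>

text \<open>Invariant: one parity class holds at least \<open>card I + bdry d\<close> possible
  positions, where \<open>I\<close> is the extremal segment. At least \<open>card I\<close> of them
  survive the shots, and Harper's theorem restores the count in the opposite class.\<close>

lemma not_winning:
  assumes "\<forall>A\<in>set H. size A \<le> bdry d"
  shows "\<not> winning Q H"
proof -
  obtain I where I: "initial V I" "I \<noteq> {}" "card I + bdry d \<le> card (nb V I)"
    using ex_card_nb_initial_lower[OF fin_V refl] by auto
  have cI: "card I > 0" using I initial_finite[OF fin_V] by (simp add: card_gt_0_iff)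
  have "\<exists>p T. T \<subseteq> Pow V \<and> card I + bdry d \<le> card T \<and>
      lift (Suc d) p ` T \<subseteq> rabbit_positions Q H i" if "i \<le> length H" for i
    using that
  proof (induction i)
    case 0
    have "card (nb V I) \<le> card (Pow V)"
      using nb_subset by (intro card_mono) auto
    then show ?case
      using I(3) pverts_eq by (intro exI[of _ True] exI[of _ "Pow V"]) auto
  next
    case (Suc i)
    then obtain p T where T: "T \<subseteq> Pow V" "card I + bdry d \<le> card T"
      "lift (Suc d) p ` T \<subseteq> rabbit_positions Q H i" by auto
    have finT: "finite T" using T(1) finite_subset by blast
    let ?A = "set_mset (H ! i)"
    let ?T = "{x \<in> T. lift (Suc d) p x \<notin> ?A}"
    have "card (T - ?T) = card (lift (Suc d) p ` (T - ?T))"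
      using T(1) by (intro card_image[symmetric] inj_on_lift) blast
    also have "\<dots> \<le> card ?A" by (intro card_mono) auto
    also have "\<dots> \<le> size (H ! i)"
      using size_mset_mono[OF mset_set_set_mset_msubset, of "H ! i"] by simp
    also have "\<dots> \<le> bdry d" using assms Suc.prems by simp
    finally have "card (T - ?T) \<le> bdry d" .
    moreover have "card (T - ?T) = card T - card ?T"
      using finT by (intro card_Diff_subset) auto
    ultimately have "card I \<le> card ?T" using T(2) by linarith
    \<comment> \<open>Harper's theorem compares families of equal size, so the survivors are trimmed
      to exactly \<open>card I\<close>.\<close>
    from obtain_subset_with_card_n[OF this]
    obtain S where S: "S \<subseteq> ?T" "card S = card I" by blast
    have "S \<subseteq> Pow V" using S T(1) by blast
    then have "card I + bdry d \<le> card (nb V S)"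
      using harper[OF fin_V _ I(1), of S] S(2) I(3) by simp
    moreover have "lift (Suc d) (\<not> p) ` nb V S \<subseteq> rabbit_positions Q H (Suc i)"
      unfolding nbhd_lift[OF \<open>S \<subseteq> Pow V\<close>, symmetric] rabbit_positions.simps
      using S(1) T(3) by (intro nbhd_mono) auto
    ultimately show ?case
      using nb_subset by (intro exI[of _ "\<not> p"] exI[of _ "nb V S"] conjI)
  qed
  then have "rabbit_positions Q H i \<noteq> {}" if "i \<le> length H" for i
    using that cI by (metis add_gr_0 card.empty image_is_empty leD subset_empty)
  then show ?thesis
    unfolding winning_def by blast
qed

section \<open>The upper bound: a winning strategy\<close>

text \<open>The inclusion lets \<open>R\<close> overestimate the positions, so that only families of
  convenient shape have to be tracked.\<close>

definition reach :: "nat set set \<Rightarrow> bool" where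
  "reach R \<longleftrightarrow> (\<exists>H\<in>hunter_strategies Q. (\<forall>A\<in>set H. size A \<le> Suc (bdry d)) \<and>
     rabbit_positions Q H (length H) \<subseteq> R)"

lemma rabbit_positions_append:
  "i \<le> length H \<Longrightarrow> rabbit_positions G (H @ K) i = rabbit_positions G H i"
  by (induction i) (auto simp: nth_append)

lemma reach_step:
  assumes "reach R" "A \<subseteq> pverts Q" "card A \<le> Suc (bdry d)" "nbhd Q (R - A) \<subseteq> R'"
  shows "reach R'"
proof -
  obtain H where H: "H \<in> hunter_strategies Q" "\<forall>A\<in>set H. size A \<le> Suc (bdry d)"
    "rabbit_positions Q H (length H) \<subseteq> R" using assms by (auto simp: reach_def)
  have "finite A" using assms(2) finite_subset by (auto simp: hypercube_def)
  let ?H = "H @ [mset_set A]"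
  have "rabbit_positions Q ?H (length ?H) = nbhd Q (rabbit_positions Q H (length H) - A)"
    using \<open>finite A\<close> by (simp add: rabbit_positions_append)
  also have "\<dots> \<subseteq> nbhd Q (R - A)" using H(3) by (intro nbhd_mono) auto
  finally show ?thesis
    unfolding reach_def using H assms(2,3,4) \<open>finite A\<close>
    by (intro bexI[of _ ?H]) (auto simp: hunter_strategies_def)
qed

lemma reach_clear_initial:
  assumes "reach (lift (Suc d) p ` I \<union> lift (Suc d) (\<not> p) ` Z)"
    and "initial V I" "Z \<subseteq> Pow V" "nb V Z \<subseteq> Z"
  shows "\<exists>q. reach (lift (Suc d) q ` Z)"
  using assms(1,2)
proof (induction "card I" arbitrary: I p rule: less_induct)
  case less
  have finI: "finite I" using less.prems initial_finite[OF fin_V] by blast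
  show ?case
  proof (cases "I = {}")
    case True
    then show ?thesis using less.prems by auto
  next
    case False
    obtain J where J: "initial V J" "J \<subseteq> I" "card J = card I - Suc (bdry d)"
      using ex_initial_card[OF fin_V less.prems(2), of "card I - Suc (bdry d)"] by auto
    have IV: "I \<subseteq> Pow V" by (rule initial_subset[OF less.prems(2)])
    let ?A = "lift (Suc d) p ` (I - J)"
    have "card ?A \<le> card (I - J)" using finI by (intro card_image_le) auto
    also have "\<dots> \<le> Suc (bdry d)"
      using J finI by (simp add: card_Diff_subset finite_subset)
    finally have cA: "card ?A \<le> Suc (bdry d)" .
    have "?A \<subseteq> pverts Q" using IV lift_in by auto
    moreover have "nbhd Q (lift (Suc d) p ` I \<union> lift (Suc d) (\<not> p) ` Z - ?A)
        \<subseteq> lift (Suc d) (\<not> p) ` nb V J \<union> lift (Suc d) (\<not> \<not> p) ` Z"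
    proof -
      have "nbhd Q (lift (Suc d) p ` I \<union> lift (Suc d) (\<not> p) ` Z - ?A)
          \<subseteq> nbhd Q (lift (Suc d) p ` J \<union> lift (Suc d) (\<not> p) ` Z)"
        by (intro nbhd_mono) auto
      also have "\<dots> = lift (Suc d) (\<not> p) ` nb V J \<union> lift (Suc d) (\<not> \<not> p) ` nb V Z"
        unfolding nbhd_Un using nbhd_lift initial_subset[OF J(1)] assms(3) by blast
      finally show ?thesis using assms(4) by blast
    qed
    ultimately have "reach (lift (Suc d) (\<not> p) ` nb V J \<union> lift (Suc d) (\<not> \<not> p) ` Z)"
      using reach_step[OF less.prems(1) _ cA] by blast
    moreover have "card (nb V J) < card I"
    proof (cases "J = {}")
      case True
      then show ?thesis using False finI by (simp add: nb_def card_gt_0_iff)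
    next
      case False
      then have "card J > 0" using J(2) finI finite_subset by (auto simp: card_gt_0_iff)
      then show ?thesis using card_nb_initial_upper[OF fin_V J(1)] J(3) by simp
    qed
    ultimately show ?thesis
      using less.hyps initial_nb[OF fin_V J(1)] by blast
  qed
qed

lemma reach_empty: "reach {}"
proof -
  have "reach (lift (Suc d) True ` Pow V \<union> lift (Suc d) (\<not> True) ` Pow V)"
    unfolding reach_def pverts_eq[symmetric, simplified]
    by (intro bexI[of _ "[]"]) (auto simp: hunter_strategies_def pverts_eq)
  then obtain q where "reach (lift (Suc d) q ` Pow V)"
    using reach_clear_initial[OF _ initial_Pow] nb_subset by blast
  then have "reach (lift (Suc d) q ` Pow V \<union> lift (Suc d) (\<not> q) ` {})" by simp
  then have "\<exists>q. reach (lift (Suc d) q ` {})"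
    by (rule reach_clear_initial[OF _ initial_Pow]) (auto simp: nb_def)
  then show ?thesis by simp
qed

lemma hunter_number_hypercube_Suc: "hunter_number Q = Suc (bdry d)"
proof -
  let ?W = "{H \<in> hunter_strategies Q. winning Q H}"
  obtain H where H: "H \<in> hunter_strategies Q" "\<forall>A\<in>set H. size A \<le> Suc (bdry d)"
    "rabbit_positions Q H (length H) = {}" using reach_empty by (auto simp: reach_def)
  then have "H \<in> ?W" by (auto simp: winning_def)
  moreover have "num_hunters H \<le> Suc (bdry d)" using H(2) by (simp add: num_hunters_def)
  ultimately have "hunter_number Q \<le> Suc (bdry d)"
    unfolding hunter_number_def by (meson bdd_below_bot cINF_lower2)
  moreover have "Suc (bdry d) \<le> num_hunters K" if "K \<in> ?W" for K
  proof (rule ccontr)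
    assume "\<not> ?thesis"
    then have "num_hunters K \<le> bdry d" by simp
    then have "\<forall>A\<in>set K. size A \<le> bdry d" by (simp add: num_hunters_def)
    then show False using not_winning that by blast
  qed
  then have "Suc (bdry d) \<le> hunter_number Q"
    unfolding hunter_number_def using \<open>H \<in> ?W\<close> by (intro cINF_greatest) auto
  ultimately show ?thesis by simp
qed

end

theorem theorem4p33:
  fixes n :: nat
  assumes "n \<ge> 1"
  shows "hunter_number (hypercube n) = 1 + (\<Sum>i<n - 1. i choose (i div 2))"
proof -
  obtain d where "n = Suc d" using assms by (cases n) auto
  then show ?thesis using hunter_number_hypercube_Suc[of d] by (simp add: bdry_def)
qed

end
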